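(* Let $d\ge 1$ be an integer and let $s>2d$. Let $\{p_k\}_{k\in\mathbb{Z}^d}$ be numbers in $[0,1]$ with $p_k=p_{-k}$ for every $k\in\mathbb{Z}^d$, and such that the limit $\lim_{\|k\|\to\infty} p_k/\|k\|^{-s}$ exists and satisfies $$0<\lim_{\|k\|\to\infty}\frac{p_k}{\|k\|^{-s}}<\infty .$$ Consider the long-range percolation random graph on $\mathbb{Z}^d$ with connection probabilities $p_{i-j}$, and let $D(x,y)$ denote the graph (chemical) distance in it. Then almost surely $$\liminf_{\|x\|\to\infty}\frac{D(0,x)}{\|x\|}>0,$$ where $x$ ranges over $\mathbb{Z}^d$.
   Context: $\|\cdot\|$ denotes the Euclidean norm. Long-range percolation: let $\{\omega_{i,j}\}_{i,j\in\mathbb{Z}^d}$ be $\{0,1\}$-valued random variables with $\omega_{i,j}=\omega_{j,i}$, $\mathbf{P}(\omega_{i,j}=1)=p_{i-j}$, $\mathbf{P}(\omega_{i,j}=0)=1-p_{i-j}$, and independent otherwise (i.e. the variables indexed by distinct unordered pairs $\{i,j\}$ are independent). The random graph has vertex set $\mathbb{Z}^d$ and an edge between $i$ and $j$ if and only if $\omega_{i,j}=1$. $D(x,y)$ is the graph distance between $x$ and $y$ in this graph, i.e. the minimal number of edges in a path from $x$ to $y$, with $D(x,y)=\infty$ if $x$ and $y$ are not in the same connected component. *)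

theory Defs
  imports "HOL-Probability.Probability" "HOL-Library.Uprod"
begin

text \<open>
  The lattice \<open>\<int>\<^sup>d\<close> is the type \<open>int ^ 'd\<close> with \<open>d = CARD('d)\<close>.  Since \<open>int\<close> is not a normed
  vector space, \<open>norm\<close> and \<open>at_infinity\<close> are not available on this type; the Euclidean norm and
  the filter \<open>\<parallel>k\<parallel> \<longlongrightarrow> \<infinity>\<close> are obtained through the embedding into \<open>real ^ 'd\<close>.
\<close>

definition lattice_norm :: "int ^ 'd \<Rightarrow> real" where
  "lattice_norm k = norm ((\<chi> i. real_of_int (k $ i)) :: real ^ 'd)"

definition lattice_at_infinity :: "(int ^ 'd) filter" where
  "lattice_at_infinity = filtercomap lattice_norm at_top"

definition is_path :: "('v \<Rightarrow> 'v \<Rightarrow> bool) \<Rightarrow> 'v \<Rightarrow> 'v list \<Rightarrow> 'v \<Rightarrow> bool" where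
  "is_path E x vs y \<longleftrightarrow>
     vs \<noteq> [] \<and> hd vs = x \<and> last vs = y \<and> distinct vs \<and> successively E vs"

text \<open>
  A path with \<open>n\<close> edges is a list of \<open>n + 1\<close> vertices.  The infimum over the empty set is \<open>\<infinity>\<close>,
  and over a nonempty set of extended naturals it is attained.
\<close>

definition graph_dist :: "('v \<Rightarrow> 'v \<Rightarrow> bool) \<Rightarrow> 'v \<Rightarrow> 'v \<Rightarrow> enat" where
  "graph_dist E x y = (INF vs\<in>{vs. is_path E x vs y}. enat (length vs - 1))"

text \<open>
  The variable \<open>\<omega>\<^sub>i\<^sub>,\<^sub>j\<close> is \<open>\<omega> (Upair i j)\<close>, with \<open>True\<close> and \<open>False\<close> in the roles of \<open>1\<close> and \<open>0\<close>.
  Indexing by unordered pairs makes \<open>\<omega>\<^sub>i\<^sub>,\<^sub>j = \<omega>\<^sub>j\<^sub>,\<^sub>i\<close> automatic, and \<open>indep_vars\<close> over all unordered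
  pairs is exactly the independence required.
\<close>

locale long_range_percolation = prob_space M
  for M :: "'a measure" +
  fixes p :: "int ^ 'd \<Rightarrow> real"
    and \<omega> :: "(int ^ 'd) uprod \<Rightarrow> 'a \<Rightarrow> bool"
  assumes indep: "indep_vars (\<lambda>_. count_space UNIV) \<omega> UNIV"
    and prob_open: "\<And>i j. prob {a \<in> space M. \<omega> (Upair i j) a} = p (i - j)"
    and prob_closed: "\<And>i j. prob {a \<in> space M. \<not> \<omega> (Upair i j) a} = 1 - p (i - j)"

definition chemical_dist ::
    "((int ^ 'd) uprod \<Rightarrow> 'a \<Rightarrow> bool) \<Rightarrow> 'a \<Rightarrow> int ^ 'd \<Rightarrow> int ^ 'd \<Rightarrow> enat" where
  "chemical_dist \<omega> a = graph_dist (\<lambda>i j. \<omega> (Upair i j) a)"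

end

theory Submission
  imports Defs "HOL-Real_Asymp.Real_Asymp"
begin

text \<open>
  The proof is a multiscale induction. Fix rapidly growing radii \<open>radius k\<close> and call a cube of scale \<open>k\<close>
  bad if some path starting in it moves further than \<open>radius k\<close> in fewer than \<open>deadline c k\<close> steps
  (\<open>fast_exit\<close>). The deadline is \<open>c * radius k\<close> up to a bounded factor, so a good cube limits the speed of
  paths to about \<open>1 / c\<close>.

  Two mechanisms can make a cube of scale \<open>k + 2\<close> bad. There may be an edge near it longer than \<open>radius k\<close>: a
  union bound over all pairs of vertices gives a probability of order \<open>radius k powr (2 * d - s)\<close> times a
  polynomial in \<open>k\<close>, which is tiny because \<open>s > 2 * d\<close>. Or there may be two bad cubes of scale \<open>k + 1\<close>
  near it that are far apart from each other: these are independent, so the probability is at most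
  the number of pairs of subcubes times the square of the probability of a bad cube. If neither happens, all bad subcubes form
  one cluster of bounded size. A path gains from such a cluster only a bounded number of subcube
  diameters, since it is enough to look at its first and last visit; elsewhere it obeys the speed limit
  of scale \<open>k + 1\<close> up to an overshoot of one edge at a time (\<open>path_displacement\<close>). Hence the larger cube is
  good for a speed limit that is larger by the factor \<open>1 + O(1 / k ^ 3)\<close> only, and the product of
  these factors converges (\<open>fast_exit_imp_obstructed\<close>, \<open>eventually_room\<close>).

  Squaring beats the polynomial number of subcubes, so a bound \<open>k powr (- M)\<close> for the probability of a bad
  cube propagates from scale to scale as soon as \<open>M > 6 * d\<close>
  (\<open>eventually_pair_budget\<close>, \<open>eventually_long_budget\<close>, \<open>prob_blocked_le\<close>). The induction needs no initial
  estimate: with \<open>c\<close> small enough, the deadline at the initial scale is at most one step, and no cube is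
  bad.

  By the Borel-Cantelli lemma, almost surely only finitely many scales are blocked around the origin
  (\<open>AE_eventually_unblocked\<close>). Beyond the last of them every path from the origin obeys the speed limit
  deterministically, first for distances well between two consecutive radii and then, with a worse constant,
  for all large distances (\<open>linear_escape\<close>).
\<close>

section \<open>The sup distance on the lattice\<close>

text \<open>
The proof covers space by cubes, so it measures distances by the maximum of the coordinate
differences. This costs only a factor \<open>sqrt d\<close> against the Euclidean norm.
\<close>

definition cheb :: "int ^ 'd \<Rightarrow> int ^ 'd \<Rightarrow> real" where
  "cheb x y = infnorm ((\<chi> i. real_of_int (x $ i) - real_of_int (y $ i)) :: real ^ 'd)"

lemma cheb_le_iff: "cheb x y \<le> r \<longleftrightarrow> (\<forall>i. real_of_int \<bar>x $ i - y $ i\<bar> \<le> r)"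
proof
  assume le: "cheb x y \<le> r"
  show "\<forall>i. real_of_int \<bar>x $ i - y $ i\<bar> \<le> r"
  proof
    fix i
    have "\<bar>(\<chi> i. real_of_int (x $ i) - real_of_int (y $ i)) $ i\<bar> \<le> cheb x y"
      unfolding cheb_def by (rule component_le_infnorm_cart)
    then show "real_of_int \<bar>x $ i - y $ i\<bar> \<le> r" using le by simp
  qed
next
  assume "\<forall>i. real_of_int \<bar>x $ i - y $ i\<bar> \<le> r"
  then show "cheb x y \<le> r"
    unfolding cheb_def infnorm_cart by (intro cSup_least) auto
qed

lemma cheb_nonneg: "0 \<le> cheb x y"
  unfolding cheb_def by (rule infnorm_pos_le)

lemma cheb_self [simp]: "cheb x x = 0"
  unfolding cheb_def by (simp add: infnorm_eq_0 vec_eq_iff)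

lemma cheb_sym: "cheb x y = cheb y x"
proof (rule antisym)
  show "cheb x y \<le> cheb y x"
    using cheb_le_iff[of y x "cheb y x"] by (simp add: cheb_le_iff[of x y] abs_minus_commute)
  show "cheb y x \<le> cheb x y"
    using cheb_le_iff[of x y "cheb x y"] by (simp add: cheb_le_iff[of y x] abs_minus_commute)
qed

lemma cheb_triangle: "cheb x z \<le> cheb x y + cheb y z"
proof -
  have "cheb x z = infnorm ((\<chi> i. real_of_int (x $ i) - real_of_int (y $ i)) +
      ((\<chi> i. real_of_int (y $ i) - real_of_int (z $ i)) :: real ^ 'a))"
    unfolding cheb_def by (rule arg_cong[where f = infnorm]) (simp add: vec_eq_iff)
  also have "\<dots> \<le> cheb x y + cheb y z"
    unfolding cheb_def by (rule infnorm_triangle)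
  finally show ?thesis .
qed

lemma lattice_norm_diff:
  "lattice_norm (x - y) = norm ((\<chi> i. real_of_int (x $ i) - real_of_int (y $ i)) :: real ^ 'd)"
  for x y :: "int ^ 'd"
  unfolding lattice_norm_def by simp

lemma cheb_le_lattice_norm: "cheb x y \<le> lattice_norm (x - y)"
  unfolding lattice_norm_diff cheb_def by (rule infnorm_le_norm)

lemma lattice_norm_le_cheb: "lattice_norm (x - y) \<le> sqrt (CARD('d)) * cheb x y"
  for x y :: "int ^ 'd"
  unfolding lattice_norm_diff cheb_def
  using norm_le_infnorm[of "(\<chi> i. real_of_int (x $ i) - real_of_int (y $ i)) :: real ^ 'd"] by simp

definition cube :: "int ^ 'd \<Rightarrow> nat \<Rightarrow> (int ^ 'd) set" where
  "cube z n = {x. cheb x z \<le> real n}"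

lemma cube_finite_card:
  fixes z :: "int ^ 'd"
  shows "finite (cube z n)" "card (cube z n) \<le> (2 * n + 1) ^ CARD('d)"
proof -
  define P where "P = (\<Pi>\<^sub>E i \<in> (UNIV :: 'd set). {z $ i - int n .. z $ i + int n})"
  have fin: "finite P"
    unfolding P_def by (intro finite_PiE) auto
  have card: "card P = (2 * n + 1) ^ CARD('d)"
    unfolding P_def by (subst card_PiE) (auto simp: algebra_simps nat_add_distrib nat_mult_distrib)
  have sub: "vec_nth ` cube z n \<subseteq> P"
  proof
    fix f assume "f \<in> vec_nth ` cube z n"
    then obtain x where x: "f = vec_nth x" "cheb x z \<le> real n"
      unfolding cube_def by auto
    have "\<bar>x $ i - z $ i\<bar> \<le> int n" for i
      using x(2) unfolding cheb_le_iff by (metis of_int_le_iff of_int_of_nat_eq)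
    then have "x $ i \<in> {z $ i - int n .. z $ i + int n}" for i
      by (smt (verit) atLeastAtMost_iff)
    then show "f \<in> P" unfolding P_def x(1) by auto
  qed
  have inj: "inj_on vec_nth (cube z n)"
    by (auto simp: inj_on_def vec_nth_inject)
  show "finite (cube z n)"
    using finite_imageD[OF finite_subset[OF sub fin] inj] .
  show "card (cube z n) \<le> (2 * n + 1) ^ CARD('d)"
    using card_mono[OF fin sub] card card_image[OF inj] by simp
qed

text \<open>
Centres of cubes of radius \<open>N\<close> that cover the cube of radius \<open>N * K\<close>. The number of centres
depends on \<open>K\<close> alone, which is what keeps the union bound over pairs of them small.
\<close>

definition grid :: "int ^ 'd \<Rightarrow> nat \<Rightarrow> nat \<Rightarrow> (int ^ 'd) set" where
  "grid v N K = (\<lambda>y. \<chi> i. v $ i + int N * y $ i) ` cube 0 K"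

lemma grid_finite_card:
  fixes v :: "int ^ 'd"
  shows "finite (grid v N K)" "card (grid v N K) \<le> (2 * K + 1) ^ CARD('d)"
  using cube_finite_card[of "0 :: int ^ 'd" K]
  by (auto simp: grid_def intro: order.trans[OF card_image_le])

lemma grid_covers:
  assumes "N > 0" "x \<in> cube v (N * K)"
  obtains z where "z \<in> grid v N K" "cheb x z \<le> real N"
proof -
  define y :: "int ^ 'a" where "y = (\<chi> i. (x $ i - v $ i) div int N)"
  have "\<bar>x $ i - v $ i\<bar> \<le> int N * int K" for i
    using assms(2) unfolding cube_def cheb_le_iff
    by (metis (mono_tags, lifting) mem_Collect_eq of_int_le_iff of_int_of_nat_eq of_nat_mult)
  then have bnd: "- (int N * int K) \<le> x $ i - v $ i" "x $ i - v $ i \<le> int N * int K" for i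
    by (smt (verit))+
  have "\<bar>y $ i\<bar> \<le> int K" for i
  proof -
    have "((- int K) * int N) div int N \<le> (x $ i - v $ i) div int N"
      by (rule zdiv_mono1) (use bnd(1)[of i] assms(1) in \<open>auto simp: mult.commute\<close>)
    moreover have "(x $ i - v $ i) div int N \<le> (int K * int N) div int N"
      by (rule zdiv_mono1) (use bnd(2)[of i] assms(1) in \<open>auto simp: mult.commute\<close>)
    moreover have "(k * int N) div int N = k" for k
      using assms(1) by simp
    ultimately have "- int K \<le> (x $ i - v $ i) div int N" "(x $ i - v $ i) div int N \<le> int K"
      by metis+
    then show ?thesis unfolding y_def by simp
  qed
  then have "real_of_int \<bar>y $ i - 0 $ i\<bar> \<le> real K" for i
    by (smt (verit) of_int_le_iff of_int_of_nat_eq zero_index)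
  then have yK: "y \<in> cube 0 K" unfolding cube_def cheb_le_iff by blast
  define z :: "int ^ 'a" where "z = (\<chi> i. v $ i + int N * y $ i)"
  have "x $ i - z $ i = (x $ i - v $ i) mod int N" for i
    unfolding z_def y_def by (simp add: minus_mult_div_eq_mod[symmetric])
  then have "\<bar>x $ i - z $ i\<bar> \<le> int N" for i
    using assms(1) pos_mod_bound[of "int N" "x $ i - v $ i"] pos_mod_sign[of "int N" "x $ i - v $ i"]
    by (simp add: less_imp_le)
  then have "real_of_int \<bar>x $ i - z $ i\<bar> \<le> real N" for i
    by (metis of_int_le_iff of_int_of_nat_eq)
  then have "cheb x z \<le> real N" unfolding cheb_le_iff by blast
  then show thesis using that yK unfolding grid_def z_def by blast
qed

section \<open>Displacement of a path that meets one bad cluster\<close>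

text \<open>
A cube is bad if some path that starts in it gets further than \<open>N\<close> from its starting point
before the time \<open>T\<close>. The path is confined to the cube of radius \<open>3 * N\<close>, so that the event depends on
finitely many edges only and cubes far apart are independent. The radius \<open>3 * N\<close> loses nothing when
steps are at most \<open>N\<close>: a path from the inner cube is then still within \<open>3 * N\<close> of the centre when it
first exceeds the displacement \<open>N\<close>.
\<close>

definition fast_exit :: "(int ^ 'd \<Rightarrow> int ^ 'd \<Rightarrow> bool) \<Rightarrow> nat \<Rightarrow> real \<Rightarrow> int ^ 'd \<Rightarrow> bool" where
  "fast_exit E N T z \<longleftrightarrow> (\<exists>u m. (\<forall>i\<le>m. u i \<in> cube z (3 * N)) \<and> (\<forall>i<m. E (u i) (u (Suc i))) \<and>
     u 0 \<in> cube z N \<and> real N < cheb (u m) (u 0) \<and> real m < T)"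

definition long_edge :: "(int ^ 'd \<Rightarrow> int ^ 'd \<Rightarrow> bool) \<Rightarrow> nat \<Rightarrow> nat \<Rightarrow> int ^ 'd \<Rightarrow> bool" where
  "long_edge E R l v \<longleftrightarrow> (\<exists>a \<in> cube v R. \<exists>b \<in> cube v R. real l < cheb a b \<and> E a b)"

definition two_fast_exits ::
    "(int ^ 'd \<Rightarrow> int ^ 'd \<Rightarrow> bool) \<Rightarrow> nat \<Rightarrow> real \<Rightarrow> nat \<Rightarrow> int ^ 'd \<Rightarrow> bool" where
  "two_fast_exits E N T K v \<longleftrightarrow> (\<exists>z \<in> grid v N K. \<exists>z' \<in> grid v N K.
     6 * real N < cheb z z' \<and> fast_exit E N T z \<and> fast_exit E N T z')"

text \<open>
Cut the time interval at the successive moments at which the displacement since the last cut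
exceeds \<open>N\<close>. Each piece takes a time at least \<open>T\<close> and overshoots \<open>N\<close> by at most one step \<open>l\<close>; the final
incomplete piece contributes the additive \<open>N\<close>.
\<close>

lemma slow_displacement:
  fixes u :: "nat \<Rightarrow> int ^ 'd"
  assumes pos: "0 < T" "0 \<le> l" "0 \<le> N"
    and step: "\<And>i. a \<le> i \<Longrightarrow> i < b \<Longrightarrow> cheb (u (Suc i)) (u i) \<le> l"
    and slow: "\<And>i j. a \<le> i \<Longrightarrow> i \<le> j \<Longrightarrow> j \<le> b \<Longrightarrow> (\<And>t. i \<le> t \<Longrightarrow> t < j \<Longrightarrow> cheb (u t) (u i) \<le> N) \<Longrightarrow>
      N < cheb (u j) (u i) \<Longrightarrow> T \<le> real (j - i)"
    and "a \<le> b"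
  shows "cheb (u b) (u a) \<le> real (b - a) / T * (N + l) + N"
  using step slow \<open>a \<le> b\<close>
proof (induction "b - a" arbitrary: a rule: less_induct)
  case less
  show ?case
  proof (cases "\<exists>j. a \<le> j \<and> j \<le> b \<and> N < cheb (u j) (u a)")
    case False
    then have "cheb (u b) (u a) \<le> N" using \<open>a \<le> b\<close> by force
    moreover have "0 \<le> real (b - a) / T * (N + l)" using pos by simp
    ultimately show ?thesis by linarith
  next
    case True
    define j where "j = (LEAST j. a \<le> j \<and> j \<le> b \<and> N < cheb (u j) (u a))"
    have j: "a \<le> j" "j \<le> b" "N < cheb (u j) (u a)"
      using LeastI_ex[OF True] unfolding j_def by auto
    have below: "cheb (u t) (u a) \<le> N" if "a \<le> t" "t < j" for t
      using not_less_Least[of t "\<lambda>j. a \<le> j \<and> j \<le> b \<and> N < cheb (u j) (u a)"] that j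
      unfolding j_def[symmetric] by auto
    have "a \<noteq> j" using j(3) pos by auto
    then have aj: "a < j" using j(1) by simp
    obtain j' where j': "j = Suc j'" using aj by (cases j) auto
    have jump: "cheb (u j) (u a) \<le> N + l"
      using cheb_triangle[of "u j" "u a" "u j'"] below[of j'] less.prems(1)[of j'] aj j j' by auto
    have T: "T \<le> real (j - a)"
      using less.prems(2)[of a j] below j by blast
    have IH: "cheb (u b) (u j) \<le> real (b - j) / T * (N + l) + N"
      by (rule less.hyps) (use aj j less.prems in auto)
    have "cheb (u b) (u a) \<le> real (b - j) / T * (N + l) + N + 1 * (N + l)"
      using order.trans[OF cheb_triangle[of "u b" "u a" "u j"] add_mono[OF IH jump]] by simp
    also have "1 * (N + l) \<le> real (j - a) / T * (N + l)"
      by (rule mult_right_mono) (use T pos in auto)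
    also have "real (b - j) / T * (N + l) + N + real (j - a) / T * (N + l)
        = real (b - a) / T * (N + l) + N"
      using aj j by (simp add: of_nat_diff add_divide_distrib diff_divide_distrib ring_distribs)
    finally show ?thesis by simp
  qed
qed

text \<open>
Bad cubes speed a path up only between its first and last visit to them. As all bad cubes are
close to each other, these two visits are at most \<open>8 * N\<close> apart, however long the path stays among the
bad cubes; before the first and after the last visit \<open>slow_displacement\<close> applies. So one cluster of bad
cubes costs an additive multiple of \<open>N\<close> and leaves the speed unchanged.
\<close>

lemma path_displacement:
  fixes u :: "nat \<Rightarrow> int ^ 'd"
  assumes "0 < N" "l \<le> N" "0 < T"
    and no_long: "\<not> long_edge E (N * K) l v"
    and cluster: "\<not> two_fast_exits E N T K v"
    and inside: "\<And>i. i \<le> m \<Longrightarrow> u i \<in> cube v (N * K)"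
    and edge: "\<And>i. i < m \<Longrightarrow> E (u i) (u (Suc i))"
  shows "cheb (u m) (u 0) \<le> real m / T * (real N + real l) + 12 * real N"
proof -
  have step: "cheb (u (Suc i)) (u i) \<le> real l" if "i < m" for i
    using no_long inside[of i] inside[of "Suc i"] edge[OF that] that
    unfolding long_edge_def by (metis Suc_leI cheb_sym less_imp_le not_le)
  define Bad where "Bad = {i. i \<le> m \<and> (\<exists>z\<in>grid v N K. cheb (u i) z \<le> N \<and> fast_exit E N T z)}"
  have slow: "T \<le> real (j - i)"
    if "i \<notin> Bad" "i \<le> j" "j \<le> m" and near: "\<And>t. i \<le> t \<Longrightarrow> t < j \<Longrightarrow> cheb (u t) (u i) \<le> N"
      and far: "real N < cheb (u j) (u i)" for i j
  proof (rule ccontr)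
    assume fast: "\<not> ?thesis"
    obtain z where z: "z \<in> grid v N K" "cheb (u i) z \<le> real N"
      using grid_covers[OF \<open>0 < N\<close> inside[of i]] order.trans[OF \<open>i \<le> j\<close> \<open>j \<le> m\<close>] by blast
    have "\<not> fast_exit E N T z"
      using z that unfolding Bad_def by auto
    moreover have "fast_exit E N T z"
      unfolding fast_exit_def
    proof (intro exI conjI allI impI)
      fix t assume t: "t \<le> j - i"
      have "cheb (u (i + t)) (u i) \<le> 2 * real N"
      proof (cases "t < j - i")
        case True
        then have "cheb (u (i + t)) (u i) \<le> real N"
          using near[of "i + t"] by simp
        also have "\<dots> \<le> 2 * real N" by simp
        finally show ?thesis .
      next
        case False
        then have "i + t = j" using t that by simp
        moreover have "i \<noteq> j" using far by auto
        then obtain j' where "j = Suc j'" "i \<le> j'" using \<open>i \<le> j\<close> by (cases j) auto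
        moreover have "cheb (u j') (u i) \<le> real N" "cheb (u j) (u j') \<le> real l"
          using near[of j'] step[of j'] calculation that by auto
        ultimately show ?thesis
          using cheb_triangle[of "u j" "u i" "u j'"] \<open>l \<le> N\<close> by simp
      qed
      then show "u (i + t) \<in> cube z (3 * N)"
        unfolding cube_def using cheb_triangle[of "u (i + t)" z "u i"] z(2) by simp
    next
      fix t assume "t < j - i"
      then show "E (u (i + t)) (u (i + Suc t))"
        using edge[of "i + t"] that by simp
    next
      show "u (i + 0) \<in> cube z N" using z unfolding cube_def by simp
      show "real N < cheb (u (i + (j - i))) (u (i + 0))" using far that by simp
      show "real (j - i) < T" using fast by simp
    qed
    ultimately show False by simp
  qed
  have stretch: "cheb (u b) (u a) \<le> real (b - a) / T * (real N + real l) + real N"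
    if "a \<le> b" "b \<le> m" "\<And>i. a \<le> i \<Longrightarrow> i \<le> b \<Longrightarrow> i \<notin> Bad" for a b
  proof (rule slow_displacement)
    fix i j assume "a \<le> i" "i \<le> j" "j \<le> b" "\<And>t. i \<le> t \<Longrightarrow> t < j \<Longrightarrow> cheb (u t) (u i) \<le> real N"
      "real N < cheb (u j) (u i)"
    then show "T \<le> real (j - i)" using slow[of i j] that by auto
  next
    show "cheb (u (Suc i)) (u i) \<le> real l" if "i < b" for i
      using step[of i] that \<open>b \<le> m\<close> by simp
  qed (use \<open>0 < T\<close> \<open>a \<le> b\<close> in simp_all)
  show ?thesis
  proof (cases "Bad = {}")
    case True
    then have "cheb (u m) (u 0) \<le> real (m - 0) / T * (real N + real l) + real N"
      by (intro stretch) simp_all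
    then show ?thesis by simp
  next
    case False
    have fin: "finite Bad" unfolding Bad_def by simp
    define a b where "a = Min Bad" and "b = Max Bad"
    have ab: "a \<in> Bad" "b \<in> Bad" "a \<le> b"
      using Min_in[OF fin False] Max_in[OF fin False] Min_le[OF fin] unfolding a_def b_def by auto
    then have "b \<le> m" unfolding Bad_def by blast
    have before: "i \<notin> Bad" if "i < a" for i
      using that fin unfolding a_def by (meson Min_le not_le)
    have after: "i \<notin> Bad" if "b < i" for i
      using that fin unfolding b_def by (meson Max_ge not_le)
    obtain z z' where zz: "z \<in> grid v N K" "cheb (u a) z \<le> N" "fast_exit E N T z"
      "z' \<in> grid v N K" "cheb (u b) z' \<le> N" "fast_exit E N T z'"
      using ab(1,2) unfolding Bad_def by blast
    have "cheb z z' \<le> 6 * real N"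
      using cluster zz unfolding two_fast_exits_def by (meson not_le)
    then have mid: "cheb (u b) (u a) \<le> 8 * real N"
      using zz cheb_triangle[of "u b" "u a" z] cheb_triangle[of "u b" z z']
      by (simp add: cheb_sym)
    have start: "cheb (u a) (u 0) \<le> real a / T * (real N + real l) + 2 * real N"
    proof (cases a)
      case 0
      then show ?thesis by simp
    next
      case (Suc a')
      have "cheb (u a') (u 0) \<le> real (a' - 0) / T * (real N + real l) + real N"
        by (rule stretch) (use Suc ab(3) \<open>b \<le> m\<close> before in auto)
      moreover have "real (a' - 0) / T * (real N + real l) \<le> real a / T * (real N + real l)"
        using Suc \<open>0 < T\<close> by (intro mult_right_mono divide_right_mono) auto
      ultimately show ?thesis
        using cheb_triangle[of "u a" "u 0" "u a'"] step[of a'] Suc ab(3) \<open>b \<le> m\<close> \<open>l \<le> N\<close> by simp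
    qed
    have finish: "cheb (u m) (u b) \<le> real (m - b) / T * (real N + real l) + 2 * real N"
    proof (cases "b = m")
      case True
      then show ?thesis by simp
    next
      case False
      have "cheb (u m) (u (Suc b)) \<le> real (m - Suc b) / T * (real N + real l) + real N"
        by (rule stretch) (use \<open>b \<le> m\<close> after False in auto)
      moreover have "real (m - Suc b) / T * (real N + real l) \<le> real (m - b) / T * (real N + real l)"
        using \<open>0 < T\<close> by (intro mult_right_mono divide_right_mono) auto
      ultimately show ?thesis
        using cheb_triangle[of "u m" "u b" "u (Suc b)"] step[of b] False \<open>b \<le> m\<close> \<open>l \<le> N\<close> by simp
    qed
    have "real a / T * (real N + real l) + real (m - b) / T * (real N + real l)
        = (real a + real (m - b)) / T * (real N + real l)"
      by (simp add: add_divide_distrib ring_distribs)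
    also have "\<dots> \<le> real m / T * (real N + real l)"
      using ab(3) \<open>b \<le> m\<close> \<open>0 < T\<close> by (intro mult_right_mono divide_right_mono) auto
    finally show ?thesis
      using start mid finish cheb_triangle[of "u m" "u 0" "u b"] cheb_triangle[of "u b" "u 0" "u a"]
      by linarith
  qed
qed


text \<open>
In the step from scale \<open>N\<close> to a larger one, the two events that a displacement bound cannot
survive.
\<close>

definition obstructed ::
    "(int ^ 'd \<Rightarrow> int ^ 'd \<Rightarrow> bool) \<Rightarrow> nat \<Rightarrow> nat \<Rightarrow> real \<Rightarrow> nat \<Rightarrow> int ^ 'd \<Rightarrow> bool" where
  "obstructed E N l T K v \<longleftrightarrow> long_edge E (N * K) l v \<or> two_fast_exits E N T K v"

text \<open>
The recursion: around a bad cube of the larger scale there is either a long edge or a pair of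
distant bad cubes of the smaller scale, since otherwise \<open>path_displacement\<close> limits the displacement. The hypothesis \<open>room\<close> quantifies how much the speed must be allowed to grow
to make up for overshoot and for the cluster of bad cubes.
\<close>

lemma fast_exit_imp_obstructed:
  assumes "0 < N" "l \<le> N" "0 < T" "3 * N' = N * K"
    and room: "T' / T * (real N + real l) + 12 * real N \<le> real N'"
    and fast: "fast_exit E N' T' v"
  shows "obstructed E N l T K v"
proof (rule ccontr)
  assume "\<not> obstructed E N l T K v"
  then have no: "\<not> long_edge E (N * K) l v" "\<not> two_fast_exits E N T K v"
    unfolding obstructed_def by auto
  obtain u m where u: "\<And>i. i \<le> m \<Longrightarrow> u i \<in> cube v (N * K)" "\<And>i. i < m \<Longrightarrow> E (u i) (u (Suc i))"
      "real N' < cheb (u m) (u 0)" "real m < T'"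
    using fast unfolding fast_exit_def assms(4) by blast
  have "cheb (u m) (u 0) \<le> real m / T * (real N + real l) + 12 * real N"
    using path_displacement[where u = u and m = m, OF assms(1-3) no] u(1,2) by blast
  also have "\<dots> \<le> T' / T * (real N + real l) + 12 * real N"
    using u(4) assms(3) by (intro add_right_mono mult_right_mono divide_right_mono) auto
  finally show False using room u(3) by simp
qed

text \<open>
The recursion starts here: with a deadline of one time unit no cube is bad.
\<close>

lemma fast_exit_needs_a_step:
  assumes "T \<le> 1"
  shows "\<not> fast_exit E N T z"
proof
  assume "fast_exit E N T z"
  then obtain u :: "nat \<Rightarrow> int ^ 'a" and m where "real N < cheb (u m) (u 0)" "real m < T"
    unfolding fast_exit_def by blast
  moreover from this assms have "m = 0" by linarith
  ultimately show False by simp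
qed

section \<open>Probability of the obstructions\<close>

abbreviation open_in :: "('v uprod \<Rightarrow> bool) \<Rightarrow> 'v \<Rightarrow> 'v \<Rightarrow> bool" where
  "open_in f \<equiv> (\<lambda>i j. f (Upair i j))"

text \<open>
All events of the construction are determined by finitely many edges. Tracking this set of edges
gives measurability and independence at once.
\<close>

definition depends_on :: "'e set \<Rightarrow> (('e \<Rightarrow> bool) \<Rightarrow> bool) \<Rightarrow> bool" where
  "depends_on S Q \<longleftrightarrow> (\<forall>f g. (\<forall>e\<in>S. f e = g e) \<longrightarrow> Q f = Q g)"

lemma depends_onI:
  assumes "\<And>f g. (\<And>e. e \<in> S \<Longrightarrow> f e = g e) \<Longrightarrow> Q f \<Longrightarrow> Q g"
  shows "depends_on S Q"
  unfolding depends_on_def using assms by metis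

lemma depends_on_restrict: "depends_on S Q \<Longrightarrow> Q (restrict f S) = Q f"
  unfolding depends_on_def by simp

definition pairs_in :: "'v set \<Rightarrow> 'v uprod set" where
  "pairs_in A = (\<lambda>(a, b). Upair a b) ` (A \<times> A)"

lemma pairs_inI: "a \<in> A \<Longrightarrow> b \<in> A \<Longrightarrow> Upair a b \<in> pairs_in A"
  unfolding pairs_in_def by auto

lemma finite_pairs_in: "finite A \<Longrightarrow> finite (pairs_in A)"
  unfolding pairs_in_def by simp

lemma pairs_in_disjoint: "A \<inter> B = {} \<Longrightarrow> pairs_in A \<inter> pairs_in B = {}"
  unfolding pairs_in_def by auto

lemma cube_disjoint: "6 * real N < cheb z z' \<Longrightarrow> cube z (3 * N) \<inter> cube z' (3 * N) = {}"
proof (rule ccontr)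
  assume far: "6 * real N < cheb z z'" and "cube z (3 * N) \<inter> cube z' (3 * N) \<noteq> {}"
  then obtain x where "cheb x z \<le> 3 * real N" "cheb x z' \<le> 3 * real N"
    unfolding cube_def by auto
  then show False
    using far cheb_triangle[of z z' x] by (simp add: cheb_sym)
qed

lemma fast_exit_depends:
  "depends_on (pairs_in (cube z (3 * N))) (\<lambda>f. fast_exit (open_in f) N T z)"
proof (rule depends_onI)
  fix f g :: "(int ^ 'a) uprod \<Rightarrow> bool"
  assume eq: "\<And>e. e \<in> pairs_in (cube z (3 * N)) \<Longrightarrow> f e = g e"
  assume "fast_exit (open_in f) N T z"
  then obtain u m where u: "\<forall>i\<le>m. u i \<in> cube z (3 * N)" "\<forall>i<m. f (Upair (u i) (u (Suc i)))"
     "u 0 \<in> cube z N" "real N < cheb (u m) (u 0)" "real m < T"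
    unfolding fast_exit_def by blast
  have "g (Upair (u i) (u (Suc i)))" if "i < m" for i
    using u(1,2) that eq[OF pairs_inI[of "u i" _ "u (Suc i)"]] by auto
  then show "fast_exit (open_in g) N T z"
    unfolding fast_exit_def using u by blast
qed

lemma long_edge_depends:
  "depends_on (pairs_in (cube v R)) (\<lambda>f. long_edge (open_in f) R l v)"
  unfolding long_edge_def by (rule depends_onI) (metis pairs_inI)

lemma two_fast_exits_depends:
  "depends_on (\<Union>z\<in>grid v N K. pairs_in (cube z (3 * N))) (\<lambda>f. two_fast_exits (open_in f) N T K v)"
proof (rule depends_onI)
  fix f g :: "(int ^ 'a) uprod \<Rightarrow> bool"
  assume eq: "\<And>e. e \<in> (\<Union>z\<in>grid v N K. pairs_in (cube z (3 * N))) \<Longrightarrow> f e = g e"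
  have "fast_exit (open_in f) N T z = fast_exit (open_in g) N T z" if "z \<in> grid v N K" for z
    using fast_exit_depends[of z N T] eq that unfolding depends_on_def by blast
  then show "two_fast_exits (open_in f) N T K v \<Longrightarrow> two_fast_exits (open_in g) N T K v"
    unfolding two_fast_exits_def by blast
qed

context long_range_percolation
begin

text \<open>
For a finite set of edges the product space of their states is discrete, so that no further
measurability condition on \<open>Q\<close> arises.
\<close>

lemma finite_dependence_event:
  assumes "finite S" "depends_on S Q"
  shows "{a \<in> space M. Q (\<lambda>e. \<omega> e a)} \<in> events"
proof -
  have "random_variable (count_space UNIV) (\<omega> e)" for e
    using indep unfolding indep_vars_def by auto
  then have X: "(\<lambda>a. restrict (\<lambda>e. \<omega> e a) S) \<in> measurable M (PiM S (\<lambda>_. count_space UNIV))"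
    by (intro measurable_restrict) auto
  have "(\<lambda>a. restrict (\<lambda>e. \<omega> e a) S) -` {f \<in> (\<Pi>\<^sub>E e\<in>S. UNIV). Q f} \<inter> space M \<in> events"
    by (rule measurable_sets[OF X]) (use assms(1) in \<open>simp add: count_space_PiM_finite\<close>)
  also have "(\<lambda>a. restrict (\<lambda>e. \<omega> e a) S) -` {f \<in> (\<Pi>\<^sub>E e\<in>S. UNIV). Q f} \<inter> space M
      = {a \<in> space M. Q (\<lambda>e. \<omega> e a)}"
    using depends_on_restrict[OF assms(2)] by auto
  finally show ?thesis .
qed

lemma prob_disjoint_dependence:
  assumes S: "finite S" "depends_on S Q" and S': "finite S'" "depends_on S' Q'"
    and disj: "S \<inter> S' = {}"
  shows "prob {a \<in> space M. Q (\<lambda>e. \<omega> e a) \<and> Q' (\<lambda>e. \<omega> e a)}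
    = prob {a \<in> space M. Q (\<lambda>e. \<omega> e a)} * prob {a \<in> space M. Q' (\<lambda>e. \<omega> e a)}"
proof -
  define X where "X S a = restrict (\<lambda>e. \<omega> e a) S" for S a
  define F where "F S Q = {f \<in> (\<Pi>\<^sub>E e\<in>S. UNIV :: bool set). Q f}" for S :: "(int ^ 'd) uprod set" and Q
  have ind: "indep_var (PiM S (\<lambda>_. count_space UNIV)) (X S) (PiM S' (\<lambda>_. count_space UNIV)) (X S')"
    unfolding X_def by (rule indep_var_restrict[OF indep disj]) auto
  have sets: "F S Q \<in> sets (PiM S (\<lambda>_. count_space UNIV))" "F S' Q' \<in> sets (PiM S' (\<lambda>_. count_space UNIV))"
    unfolding F_def using S S' by (simp_all add: count_space_PiM_finite)
  have "X S a \<in> F S Q \<longleftrightarrow> Q (\<lambda>e. \<omega> e a)" "X S' a \<in> F S' Q' \<longleftrightarrow> Q' (\<lambda>e. \<omega> e a)" for a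
    unfolding X_def F_def using depends_on_restrict[OF S(2)] depends_on_restrict[OF S'(2)] by auto
  then have eqs: "X S -` F S Q \<inter> space M = {a \<in> space M. Q (\<lambda>e. \<omega> e a)}"
      "X S' -` F S' Q' \<inter> space M = {a \<in> space M. Q' (\<lambda>e. \<omega> e a)}"
      "(\<lambda>a. (X S a, X S' a)) -` (F S Q \<times> F S' Q') \<inter> space M
        = {a \<in> space M. Q (\<lambda>e. \<omega> e a) \<and> Q' (\<lambda>e. \<omega> e a)}"
    by auto
  show ?thesis
    using indep_varD[OF ind sets] unfolding eqs .
qed

abbreviation graph :: "'a \<Rightarrow> int ^ 'd \<Rightarrow> int ^ 'd \<Rightarrow> bool" where
  "graph a \<equiv> open_in (\<lambda>e. \<omega> e a)"

lemma fast_exit_event: "{a \<in> space M. fast_exit (graph a) N T z} \<in> events"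
  by (rule finite_dependence_event[OF finite_pairs_in[OF cube_finite_card(1)] fast_exit_depends])

lemma long_edge_event: "{a \<in> space M. long_edge (graph a) R l v} \<in> events"
  by (rule finite_dependence_event[OF finite_pairs_in[OF cube_finite_card(1)] long_edge_depends])

lemma two_fast_exits_event: "{a \<in> space M. two_fast_exits (graph a) N T K v} \<in> events"
  by (rule finite_dependence_event[OF _ two_fast_exits_depends])
    (simp add: finite_pairs_in cube_finite_card(1) grid_finite_card(1))

lemma obstructed_event: "{a \<in> space M. obstructed (graph a) N l T K v} \<in> events"
proof -
  have "{a \<in> space M. obstructed (graph a) N l T K v} =
      {a \<in> space M. long_edge (graph a) (N * K) l v} \<union> {a \<in> space M. two_fast_exits (graph a) N T K v}"
    unfolding obstructed_def by auto
  then show ?thesis using long_edge_event two_fast_exits_event by simp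
qed

lemma prob_union_bound:
  assumes "finite I" "\<And>i. i \<in> I \<Longrightarrow> {a \<in> space M. P i a} \<in> events"
    and "\<And>i. i \<in> I \<Longrightarrow> prob {a \<in> space M. P i a} \<le> \<epsilon>" "card I \<le> n" "0 \<le> \<epsilon>"
  shows "prob {a \<in> space M. \<exists>i\<in>I. P i a} \<le> real n * \<epsilon>"
proof -
  have "{a \<in> space M. \<exists>i\<in>I. P i a} = (\<Union>i\<in>I. {a \<in> space M. P i a})" by auto
  then have "prob {a \<in> space M. \<exists>i\<in>I. P i a} \<le> (\<Sum>i\<in>I. prob {a \<in> space M. P i a})"
    using assms by (auto intro!: finite_measure_subadditive_finite)
  also have "\<dots> \<le> real (card I) * \<epsilon>"
    using assms(3) by (rule sum_bounded_above)
  also have "\<dots> \<le> real n * \<epsilon>"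
    using assms by (intro mult_right_mono) auto
  finally show ?thesis .
qed

text \<open>
The crude count of all pairs of vertices in the cube suffices: it is of order \<open>R ^ (2 * d)\<close>, which
the decay of \<open>p\<close> beats exactly because \<open>s > 2 * d\<close>.
\<close>

lemma prob_long_edge:
  assumes "\<And>k. real l < lattice_norm k \<Longrightarrow> p k \<le> \<delta>" "0 \<le> \<delta>"
  shows "prob {a \<in> space M. long_edge (graph a) R l v} \<le> real ((2 * R + 1) ^ CARD('d)) ^ 2 * \<delta>"
proof -
  define I where "I = {(x, y) \<in> cube v R \<times> cube v R. real l < cheb x y}"
  have sub: "I \<subseteq> cube v R \<times> cube v R" unfolding I_def by auto
  have fin: "finite (cube v R \<times> cube v R)" using cube_finite_card(1) by blast
  have "{a \<in> space M. long_edge (graph a) R l v} = {a \<in> space M. \<exists>e\<in>I. \<omega> (Upair (fst e) (snd e)) a}"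
    unfolding long_edge_def I_def by fastforce
  also have "prob \<dots> \<le> real (((2 * R + 1) ^ CARD('d)) ^ 2) * \<delta>"
  proof (rule prob_union_bound[OF finite_subset[OF sub fin]])
    show "{a \<in> space M. \<omega> (Upair (fst e) (snd e)) a} \<in> events" for e
      by (rule finite_dependence_event[of "{Upair (fst e) (snd e)}" "\<lambda>f. f (Upair (fst e) (snd e))"])
        (auto simp: depends_on_def)
    show "prob {a \<in> space M. \<omega> (Upair (fst e) (snd e)) a} \<le> \<delta>" if "e \<in> I" for e
      unfolding prob_open
      using that assms(1) cheb_le_lattice_norm order.strict_trans2 unfolding I_def by fastforce
    have "card I \<le> card (cube v R) * card (cube v R)"
      using card_mono[OF fin sub] by (simp add: card_cartesian_product)
    also have "\<dots> \<le> ((2 * R + 1) ^ CARD('d)) ^ 2"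
      unfolding power2_eq_square by (intro mult_mono cube_finite_card) auto
    finally show "card I \<le> ((2 * R + 1) ^ CARD('d)) ^ 2" .
  qed (fact assms(2))
  finally show ?thesis by simp
qed

text \<open>
Independence squares the probability of a single bad cube. This gain outweighs the number of
pairs of cubes and drives the induction over scales.
\<close>

lemma prob_two_fast_exits:
  assumes "\<And>z. prob {a \<in> space M. fast_exit (graph a) N T z} \<le> \<epsilon>"
  shows "prob {a \<in> space M. two_fast_exits (graph a) N T K v} \<le> real ((2 * K + 1) ^ CARD('d)) ^ 2 * \<epsilon> ^ 2"
proof -
  define I where "I = {(x, y) \<in> grid v N K \<times> grid v N K. 6 * real N < cheb x y}"
  have sub: "I \<subseteq> grid v N K \<times> grid v N K" unfolding I_def by auto
  have fin: "finite (grid v N K \<times> grid v N K)" using grid_finite_card(1) by blast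
  have "{a \<in> space M. two_fast_exits (graph a) N T K v} =
      {a \<in> space M. \<exists>e\<in>I. fast_exit (graph a) N T (fst e) \<and> fast_exit (graph a) N T (snd e)}"
    unfolding two_fast_exits_def I_def by fastforce
  also have "prob \<dots> \<le> real (((2 * K + 1) ^ CARD('d)) ^ 2) * \<epsilon> ^ 2"
  proof (rule prob_union_bound[OF finite_subset[OF sub fin]])
    fix e assume e: "e \<in> I"
    have "{a \<in> space M. fast_exit (graph a) N T (fst e) \<and> fast_exit (graph a) N T (snd e)} =
       {a \<in> space M. fast_exit (graph a) N T (fst e)} \<inter> {a \<in> space M. fast_exit (graph a) N T (snd e)}"
      by auto
    then show "{a \<in> space M. fast_exit (graph a) N T (fst e) \<and> fast_exit (graph a) N T (snd e)} \<in> events"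
      using fast_exit_event by auto
    have "prob {a \<in> space M. fast_exit (graph a) N T (fst e) \<and> fast_exit (graph a) N T (snd e)}
      = prob {a \<in> space M. fast_exit (graph a) N T (fst e)} * prob {a \<in> space M. fast_exit (graph a) N T (snd e)}"
      by (rule prob_disjoint_dependence[OF finite_pairs_in[OF cube_finite_card(1)] fast_exit_depends
            finite_pairs_in[OF cube_finite_card(1)] fast_exit_depends pairs_in_disjoint[OF cube_disjoint]])
        (use e I_def in auto)
    also have "\<dots> \<le> \<epsilon> * \<epsilon>"
      using assms order.trans[OF measure_nonneg assms] by (intro mult_mono) auto
    finally show "prob {a \<in> space M. fast_exit (graph a) N T (fst e) \<and> fast_exit (graph a) N T (snd e)} \<le> \<epsilon> ^ 2"
      by (simp add: power2_eq_square)
  next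
    have "card I \<le> card (grid v N K) * card (grid v N K)"
      using card_mono[OF fin sub] by (simp add: card_cartesian_product)
    also have "\<dots> \<le> ((2 * K + 1) ^ CARD('d)) ^ 2"
      unfolding power2_eq_square by (intro mult_mono grid_finite_card) auto
    finally show "card I \<le> ((2 * K + 1) ^ CARD('d)) ^ 2" .
  qed simp
  finally show ?thesis by simp
qed

lemma prob_obstructed:
  assumes "\<And>k. real l < lattice_norm k \<Longrightarrow> p k \<le> \<delta>" "0 \<le> \<delta>"
    and "\<And>z. prob {a \<in> space M. fast_exit (graph a) N T z} \<le> \<epsilon>"
  shows "prob {a \<in> space M. obstructed (graph a) N l T K v}
    \<le> real ((2 * (N * K) + 1) ^ CARD('d)) ^ 2 * \<delta> + real ((2 * K + 1) ^ CARD('d)) ^ 2 * \<epsilon> ^ 2"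
proof -
  have "{a \<in> space M. obstructed (graph a) N l T K v} =
      {a \<in> space M. long_edge (graph a) (N * K) l v} \<union> {a \<in> space M. two_fast_exits (graph a) N T K v}"
    unfolding obstructed_def by auto
  then have "prob {a \<in> space M. obstructed (graph a) N l T K v} \<le>
     prob {a \<in> space M. long_edge (graph a) (N * K) l v} + prob {a \<in> space M. two_fast_exits (graph a) N T K v}"
    using measure_Un_le[OF long_edge_event two_fast_exits_event] by simp
  then show ?thesis
    using prob_long_edge[OF assms(1,2)] prob_two_fast_exits[OF assms(3)] by (meson add_mono order.trans)
qed

end


section \<open>Scales and deadlines\<close>

text \<open>
The ratio \<open>(k + 1) ^ 3\<close> of consecutive radii is polynomial in \<open>k\<close>, so the number of subcubes is
polynomial, while the relative errors caused by overshoot and by the bad cluster are of order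
\<open>1 / k ^ 3\<close> and hence summable. The radii themselves grow faster than exponentially, which makes
long edges negligible.
\<close>

definition radius :: "nat \<Rightarrow> nat" where
  "radius k = fact k ^ 3"

text \<open>
A speed bound of \<open>1 / c\<close> up to the factor \<open>1 + 1 / (k + 1)\<close>. From one scale to the next this factor
decreases by about \<open>1 / k ^ 2\<close>, which leaves room for errors of order \<open>1 / k ^ 3\<close>, yet it never falls
below 1.
\<close>

definition deadline :: "real \<Rightarrow> nat \<Rightarrow> real" where
  "deadline c k = c * (1 + 1 / (real k + 1)) * real (radius k)"

text \<open>
The obstruction to passing from scale \<open>k + 1\<close> to \<open>k + 2\<close>, in the cube of radius
\<open>3 * radius (k + 2)\<close>. An edge counts as long from \<open>radius k\<close> on, which is \<open>radius (k + 1)\<close> divided by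
\<open>(k + 1) ^ 3\<close>, so the overshoot is a small fraction of the radius of the subcubes.
\<close>

definition blocked :: "(int ^ 'd \<Rightarrow> int ^ 'd \<Rightarrow> bool) \<Rightarrow> real \<Rightarrow> nat \<Rightarrow> int ^ 'd \<Rightarrow> bool" where
  "blocked E c k v \<longleftrightarrow>
     obstructed E (radius (k + 1)) (radius k) (deadline c (k + 1)) (3 * (k + 2) ^ 3) v"

lemma radius_pos: "0 < radius k"
  unfolding radius_def by simp

lemma radius_Suc: "radius (Suc k) = (k + 1) ^ 3 * radius k"
  unfolding radius_def fact_Suc by (simp only: power_mult_distrib of_nat_id Suc_eq_plus1)

lemma radius_mono: "j \<le> k \<Longrightarrow> radius j \<le> radius k"
  unfolding radius_def by (intro power_mono fact_mono) auto

lemma le_radius: "k \<le> radius k"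
proof -
  have "k \<le> fact k" by (rule fact_ge_self)
  also have "\<dots> \<le> fact k ^ 3" by (rule self_le_power) auto
  finally show ?thesis unfolding radius_def .
qed

lemma two_power_le_radius: "2 ^ k / 2 \<le> real (radius k)"
proof (induction k)
  case 0
  then show ?case by (simp add: radius_def)
next
  case (Suc k)
  show ?case
  proof (cases "k = 0")
    case True
    then show ?thesis by (simp add: radius_def)
  next
    case False
    have "(2::nat) ^ 1 \<le> (k + 1) ^ 1" using False by simp
    also have "(k + 1) ^ 1 \<le> (k + 1) ^ 3" by (rule power_increasing) auto
    finally have "2 * radius k \<le> radius (Suc k)" unfolding radius_Suc by simp
    then have "real (2 * radius k) \<le> real (radius (Suc k))" by (rule of_nat_mono)
    moreover have "2 ^ Suc k / 2 = 2 * (2 ^ k / (2 :: real))" by simp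
    ultimately show ?thesis using Suc by linarith
  qed
qed

lemma cube_side: "radius (k + 1) * (3 * (k + 2) ^ 3) = 3 * radius (k + 2)"
  using radius_Suc[of "k + 1"] by simp

lemma deadline_pos: "0 < c \<Longrightarrow> 0 < deadline c k"
  unfolding deadline_def using radius_pos[of k] by (simp add: add_pos_nonneg)

lemma deadline_lower: "0 < c \<Longrightarrow> c * real (radius k) \<le> deadline c k"
  unfolding deadline_def by (intro mult_right_mono) (auto simp: mult_le_cancel_left1)

lemma deadline_upper: "0 < c \<Longrightarrow> deadline c k \<le> c * 2 * real (radius k)"
  unfolding deadline_def by (intro mult_right_mono mult_left_mono) (auto simp: field_simps)

lemma eventually_room:
  "\<forall>\<^sub>F k in sequentially. \<forall>c>0.
     deadline c (k + 2) / deadline c (k + 1) * (real (radius (k + 1)) + real (radius k)) +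
       12 * real (radius (k + 1)) \<le> real (radius (k + 2))"
proof -
  have "\<forall>\<^sub>F k in sequentially. (1 + 1 / (real k + 3)) / (1 + 1 / (real k + 2)) *
     (real k + 2) ^ 3 * (1 + 1 / (real k + 1) ^ 3) + 12 \<le> (real k + 2) ^ 3"
    by real_asymp
  then show ?thesis
  proof eventually_elim
    case (elim k)
    show ?case
    proof (intro allI impI)
      fix c :: real assume "0 < c"
      define N where "N = real (radius (k + 1))"
      have N: "0 < N" unfolding N_def using radius_pos by simp
      have s0: "real (radius k) = N * (1 / (real k + 1) ^ 3)"
        unfolding N_def by (simp add: radius_Suc add.commute)
      have s2: "real (radius (k + 2)) = (real k + 2) ^ 3 * N"
        unfolding N_def using radius_Suc[of "k + 1"] by (simp add: add.commute)
      have ratio: "deadline c (k + 2) / deadline c (k + 1) =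
          (1 + 1 / (real k + 3)) / (1 + 1 / (real k + 2)) * (real k + 2) ^ 3"
      proof -
        have "deadline c (k + 2) = c * (1 + 1 / (real k + 3)) * ((real k + 2) ^ 3 * N)"
          unfolding deadline_def s2 by (simp add: add.commute)
        moreover have "deadline c (k + 1) = c * (1 + 1 / (real k + 2)) * N"
          unfolding deadline_def N_def by (simp add: add.commute)
        ultimately show ?thesis using N \<open>0 < c\<close> by simp
      qed
      have "deadline c (k + 2) / deadline c (k + 1) * (N + real (radius k)) + 12 * N =
        ((1 + 1 / (real k + 3)) / (1 + 1 / (real k + 2)) * (real k + 2) ^ 3 *
          (1 + 1 / (real k + 1) ^ 3) + 12) * N"
        unfolding ratio s0 by (simp add: algebra_simps)
      also have "\<dots> \<le> (real k + 2) ^ 3 * N"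
        using elim N by (intro mult_right_mono) auto
      finally show "deadline c (k + 2) / deadline c (k + 1) * (real (radius (k + 1)) + real (radius k)) +
       12 * real (radius (k + 1)) \<le> real (radius (k + 2))"
        unfolding s2 N_def .
    qed
  qed
qed

text \<open>
Any exponent \<open>M > 6 * d\<close> would do: there are about \<open>k ^ (6 * d)\<close> pairs of subcubes, and
\<open>k ^ (6 * d) * (k ^ (- M)) ^ 2\<close> must stay below \<open>k ^ (- M)\<close>.
\<close>

definition tolerance :: "nat \<Rightarrow> nat \<Rightarrow> real" where
  "tolerance d k = 1 / real k ^ (6 * d + 1)"

lemma eventually_pair_budget:
  "\<forall>\<^sub>F k in sequentially. real ((2 * (3 * (k + 2) ^ 3) + 1) ^ d) ^ 2 * tolerance d (k + 1) ^ 2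
     \<le> tolerance d (k + 2) / 2"
proof -
  define B :: real where "B = 2 * 49 ^ d * 2 ^ (12 * d + 1)"
  have "\<forall>\<^sub>F k in sequentially. B \<le> real k + 1" by real_asymp
  then show ?thesis
  proof eventually_elim
    case (elim k)
    define y where "y = real k + 1"
    have y: "1 \<le> y" "0 < y" unfolding y_def by auto
    define x where "x = real k + 2"
    have x: "0 < x" "x \<le> 2 * y" "1 \<le> x ^ 3" unfolding x_def y_def by auto
    have "real ((2 * (3 * (k + 2) ^ 3) + 1) ^ d) = (6 * x ^ 3 + 1) ^ d"
      unfolding x_def by (simp add: add.commute)
    also have "\<dots> \<le> (7 * x ^ 3) ^ d"
      using x by (intro power_mono) auto
    finally have "real ((2 * (3 * (k + 2) ^ 3) + 1) ^ d) ^ 2 \<le> ((7 * x ^ 3) ^ d) ^ 2"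
      by (intro power_mono) auto
    also have "\<dots> = 49 ^ d * x ^ (6 * d)"
    proof -
      have "((7 * x ^ 3) ^ d) ^ 2 = ((7 * x ^ 3) ^ 2) ^ d" by (metis power_mult mult.commute)
      also have "(7 * x ^ 3) ^ 2 = 49 * x ^ 6" by (simp add: power_mult_distrib flip: power_mult)
      finally show ?thesis by (simp add: power_mult_distrib power_mult)
    qed
    finally have 1: "real ((2 * (3 * (k + 2) ^ 3) + 1) ^ d) ^ 2 * tolerance d (k + 1) ^ 2
        \<le> 49 ^ d * x ^ (6 * d) * tolerance d (k + 1) ^ 2"
      by (intro mult_right_mono) auto
    have 2: "tolerance d (k + 1) ^ 2 = 1 / (y ^ (12 * d + 1) * y)"
    proof -
      have "(6 * d + 1) * 2 = Suc (12 * d + 1)" by simp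
      then have "(y ^ (6 * d + 1)) ^ 2 = y ^ (12 * d + 1) * y"
        by (metis power_mult power_Suc2)
      then show ?thesis unfolding tolerance_def y_def by (simp add: power_one_over add.commute)
    qed
    have "2 * 49 ^ d * (x ^ (6 * d) * x ^ (6 * d + 1)) = 2 * 49 ^ d * x ^ (12 * d + 1)"
      by (simp flip: power_add)
    also have "\<dots> \<le> 2 * 49 ^ d * (2 * y) ^ (12 * d + 1)"
      using x by (intro mult_left_mono power_mono) auto
    also have "\<dots> = B * y ^ (12 * d + 1)"
      unfolding B_def power_mult_distrib by simp
    also have "\<dots> \<le> y * y ^ (12 * d + 1)"
      using elim y unfolding y_def by (intro mult_right_mono) auto
    finally have 3: "2 * 49 ^ d * (x ^ (6 * d) * x ^ (6 * d + 1)) \<le> y ^ (12 * d + 1) * y"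
      by (simp add: mult.commute)
    have "49 ^ d * x ^ (6 * d) * tolerance d (k + 1) ^ 2 \<le> 1 / x ^ (6 * d + 1) / 2"
      unfolding 2 using 3 x y by (simp add: divide_simps mult_ac)
    also have "\<dots> = tolerance d (k + 2) / 2"
      unfolding tolerance_def x_def by (simp add: add.commute)
    finally show ?case using 1 by linarith
  qed
qed

text \<open>
With \<open>S = radius k\<close> the left-hand side is a polynomial in \<open>k\<close> times \<open>S powr (2 * d - s)\<close>, and \<open>S\<close>
grows at least exponentially.
\<close>

lemma eventually_long_budget:
  fixes s C :: real
  assumes "s > 2 * real d" "0 \<le> C"
  shows "\<forall>\<^sub>F k in sequentially.
     real ((2 * (radius (k + 1) * (3 * (k + 2) ^ 3)) + 1) ^ d) ^ 2 * (C * real (radius k) powr (- s))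
       \<le> tolerance d (k + 2) / 2"
proof -
  define \<sigma> where "\<sigma> = s - 2 * real d"
  have \<sigma>: "\<sigma> > 0" using assms \<sigma>_def by simp
  define n where "n = 18 * d + 1"
  define B where "B = 2 * C * 49 ^ d"
  \<comment> \<open>The exponent \<open>12 * d\<close> of the number of pairs of vertices plus \<open>6 * d + 1\<close> from the tolerance.\<close>
  have "((\<lambda>k. B * ((real k + 2) ^ n * (2 ^ k / 2) powr (- \<sigma>))) \<longlongrightarrow> 0) sequentially"
    using \<sigma> by real_asymp
  then have "\<forall>\<^sub>F k in sequentially. B * ((real k + 2) ^ n * (2 ^ k / 2) powr (- \<sigma>)) < 1"
    by (rule order_tendstoD) simp
  then show ?thesis
  proof eventually_elim
    case (elim k)
    define x where "x = real k + 2"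
    have x: "1 \<le> x" "0 < x" unfolding x_def by auto
    define S where "S = real (radius k)"
    have S: "1 \<le> S" "0 < S" unfolding S_def using radius_pos[of k] by auto
    have "real (radius (k + 2)) = (real k + 2) ^ 3 * (real k + 1) ^ 3 * S"
      unfolding S_def using radius_Suc[of "k + 1"] radius_Suc[of k] by (simp add: add.commute)
    also have "\<dots> \<le> x ^ 3 * x ^ 3 * S"
      unfolding x_def using S by (intro mult_right_mono mult_left_mono power_mono) auto
    also have "\<dots> = x ^ 6 * S" by (simp flip: power_add)
    finally have sc: "real (radius (k + 2)) \<le> x ^ 6 * S" .
    have one: "1 \<le> x ^ 6 * S"
      using x S by (metis mult_mono' one_le_power mult_1 zero_le_one)
    have "real ((2 * (radius (k + 1) * (3 * (k + 2) ^ 3)) + 1) ^ d) = (6 * real (radius (k + 2)) + 1) ^ d"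
      unfolding cube_side by (simp add: add.commute)
    also have "\<dots> \<le> (7 * (x ^ 6 * S)) ^ d"
      using sc one by (intro power_mono) auto
    finally have "real ((2 * (radius (k + 1) * (3 * (k + 2) ^ 3)) + 1) ^ d) ^ 2 \<le> ((7 * (x ^ 6 * S)) ^ d) ^ 2"
      by (intro power_mono) auto
    also have "\<dots> = 49 ^ d * x ^ (12 * d) * S ^ (2 * d)"
    proof -
      have "((7 * (x ^ 6 * S)) ^ d) ^ 2 = ((7 * (x ^ 6 * S)) ^ 2) ^ d"
        by (metis power_mult mult.commute)
      also have "(7 * (x ^ 6 * S)) ^ 2 = 49 * x ^ 12 * S ^ 2"
        by (simp add: power_mult_distrib flip: power_mult)
      finally show ?thesis by (simp add: power_mult_distrib power_mult)
    qed
    finally have "real ((2 * (radius (k + 1) * (3 * (k + 2) ^ 3)) + 1) ^ d) ^ 2 * (C * S powr (- s))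
       \<le> 49 ^ d * x ^ (12 * d) * S ^ (2 * d) * (C * S powr (- s))"
      using assms by (intro mult_right_mono) auto
    also have "\<dots> = C * 49 ^ d * x ^ (12 * d) * (S powr (2 * real d) * S powr (- s))"
      using S powr_realpow[of S "2 * d"] by simp
    also have "S powr (2 * real d) * S powr (- s) = S powr (- \<sigma>)"
      unfolding \<sigma>_def by (simp flip: powr_add)
    also have "C * 49 ^ d * x ^ (12 * d) * S powr (- \<sigma>) \<le> C * 49 ^ d * x ^ (12 * d) * (2 ^ k / 2) powr (- \<sigma>)"
      using assms x \<sigma> two_power_le_radius[of k] unfolding S_def
      by (intro mult_left_mono powr_mono2') auto
    also have "\<dots> \<le> 1 / x ^ (6 * d + 1) / 2"
    proof -
      have "x ^ n = x ^ (12 * d) * x ^ (6 * d + 1)"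
        unfolding n_def by (simp flip: power_add)
      then have "2 * (C * 49 ^ d * x ^ (12 * d) * (2 ^ k / 2) powr (- \<sigma>)) * x ^ (6 * d + 1) \<le> 1"
        using elim unfolding B_def x_def[symmetric] by (simp add: mult_ac)
      then show ?thesis using x by (simp add: pos_le_divide_eq mult_ac)
    qed
    also have "\<dots> = tolerance d (k + 2) / 2"
      unfolding tolerance_def x_def by (simp add: add.commute)
    finally show ?case unfolding S_def .
  qed
qed

section \<open>Linear escape along unblocked scales\<close>

text \<open>
An edge from a cube of one scale cannot leave the tripled cube. Otherwise consider the first scale
whose tripled cube contains its far end: there it is a long edge, and that scale would be blocked. In
this way edges of unbounded length are controlled through finite cubes only.
\<close>

lemma edge_stays:
  assumes unblocked: "\<And>j. k \<le> j \<Longrightarrow> \<not> blocked E c j 0"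
    and "x \<in> cube 0 (radius (k + 2))" "E x y"
  shows "y \<in> cube 0 (3 * radius (k + 2))"
proof (rule ccontr)
  assume out: "y \<notin> cube 0 (3 * radius (k + 2))"
  obtain n where "cheb y 0 \<le> real n" using real_arch_simple by blast
  also have "real n \<le> 3 * real (radius (n + 2))"
    using le_radius[of n] radius_mono[of n "n + 2"] by simp
  finally have ex: "\<exists>j. y \<in> cube 0 (3 * radius (j + 2))" unfolding cube_def by auto
  define j where "j = (LEAST j. y \<in> cube 0 (3 * radius (j + 2)))"
  have j: "y \<in> cube 0 (3 * radius (j + 2))" using LeastI_ex[OF ex] unfolding j_def .
  have "k < j"
  proof (rule ccontr)
    assume "\<not> k < j"
    then have "radius (j + 2) \<le> radius (k + 2)" by (intro radius_mono) auto
    then have "real (radius (j + 2)) \<le> real (radius (k + 2))" by simp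
    then show False using j out unfolding cube_def by simp
  qed
  then obtain i where i: "j = Suc i" "k \<le> i" by (cases j) auto
  have "y \<notin> cube 0 (3 * radius (i + 2))"
    using not_less_Least[of i "\<lambda>j. y \<in> cube 0 (3 * radius (j + 2))"] i unfolding j_def[symmetric] by simp
  then have far: "3 * real (radius (j + 1)) < cheb y 0"
    unfolding cube_def i by simp
  have "radius (k + 2) \<le> radius (j + 1)" "radius j \<le> radius (j + 1)" "radius (j + 1) \<le> 3 * radius (j + 2)"
    using i radius_mono[of "k + 2" "j + 1"] radius_mono[of j "j + 1"] radius_mono[of "j + 1" "j + 2"] by auto
  then have sc: "real (radius (k + 2)) \<le> real (radius (j + 1))" "real (radius j) \<le> real (radius (j + 1))"
      "real (radius (j + 1)) \<le> 3 * real (radius (j + 2))"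
    using of_nat_mono[of _ _, where 'a = real] by fastforce+
  have "0 < real (radius (j + 1))" using radius_pos[of "j + 1"] by simp
  then have "real (radius j) < cheb x y"
    using far sc assms(2) cheb_triangle[of y 0 x] unfolding cube_def by (simp add: cheb_sym)
  moreover have "x \<in> cube 0 (3 * radius (j + 2))"
    using assms(2) sc unfolding cube_def by simp
  ultimately have "long_edge E (3 * radius (j + 2)) (radius j) 0"
    using j \<open>E x y\<close> unfolding long_edge_def by blast
  then have "blocked E c j 0"
    unfolding blocked_def obstructed_def cube_side by simp
  then show False using unblocked[of j] \<open>k < j\<close> by simp
qed

text \<open>
Stop the path when it first reaches the distance \<open>R\<close>. Until then it stays in the cube to which the
displacement bound applies, and for \<open>R\<close> at least \<open>24 * radius (k + 1)\<close> at least half of \<open>R\<close> remains after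
the additive loss \<open>12 * radius (k + 1)\<close>.
\<close>

lemma escape_within_radius:
  assumes "0 < c" and unblocked: "\<And>j. k \<le> j \<Longrightarrow> \<not> blocked E c j 0"
    and u: "u 0 = 0" "\<And>i. i < m \<Longrightarrow> E (u i) (u (Suc i))"
    and R: "24 * real (radius (k + 1)) \<le> R" "R \<le> real (radius (k + 2))" "R \<le> cheb (u m) 0"
  shows "c / 4 * R \<le> real m"
proof -
  define N where "N = radius (k + 1)"
  have N: "0 < N" "radius k \<le> N" unfolding N_def using radius_pos radius_mono[of k "k + 1"] by auto
  define T where "T = deadline c (k + 1)"
  have T: "0 < T" "c * real N \<le> T" unfolding T_def N_def using deadline_pos deadline_lower \<open>0 < c\<close> by auto
  define n where "n = (LEAST i. R \<le> cheb (u i) 0)"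
  have n: "R \<le> cheb (u n) 0" "n \<le> m"
    using LeastI[of "\<lambda>i. R \<le> cheb (u i) 0" m] Least_le[of "\<lambda>i. R \<le> cheb (u i) 0" m] R(3) unfolding n_def by auto
  have small: "u i \<in> cube 0 (radius (k + 2))" if "i < n" for i
    using not_less_Least[of i "\<lambda>i. R \<le> cheb (u i) 0"] that R(2) unfolding n_def[symmetric] cube_def by simp
  have inside: "u i \<in> cube 0 (N * (3 * (k + 2) ^ 3))" if "i \<le> n" for i
    unfolding N_def cube_side
  proof (cases i)
    case 0
    then show "u i \<in> cube 0 (3 * radius (k + 2))" using u(1) unfolding cube_def by simp
  next
    case (Suc i')
    then show "u i \<in> cube 0 (3 * radius (k + 2))"
      using edge_stays[OF unblocked small[of i'] u(2)[of i']] that n(2) by simp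
  qed
  have no: "\<not> long_edge E (N * (3 * (k + 2) ^ 3)) (radius k) 0"
      "\<not> two_fast_exits E N T (3 * (k + 2) ^ 3) 0"
    using unblocked[of k] unfolding blocked_def obstructed_def N_def T_def by auto
  have "R \<le> cheb (u n) (u 0)" using n u by simp
  also have "\<dots> \<le> real n / T * (real N + real (radius k)) + 12 * real N"
    by (rule path_displacement[OF N T(1) no]) (use inside u n in auto)
  also have "\<dots> \<le> real m / (c * real N) * (2 * real N) + 12 * real N"
    using n(2) N T \<open>0 < c\<close> by (intro add_right_mono mult_mono frac_le) auto
  also have "real m / (c * real N) * (2 * real N) = 2 * real m / c"
    using N \<open>0 < c\<close> by simp
  finally have "R / 2 \<le> 2 * real m / c"
    using R(1) unfolding N_def by simp
  then show ?thesis using \<open>0 < c\<close> by (simp add: field_simps)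
qed

text \<open>
The ranges of \<open>escape_within_radius\<close> leave gaps between \<open>radius (j + 2)\<close> and \<open>24 * radius (j + 2)\<close>. A path
that ends in such a gap has passed the distance \<open>radius (j + 2)\<close> before, and this loses only the
factor 24 in the speed.
\<close>

lemma linear_escape:
  assumes "0 < c" "1 \<le> k" and unblocked: "\<And>j. k \<le> j \<Longrightarrow> \<not> blocked E c j 0"
    and u: "u 0 = 0" "\<And>i. i < m \<Longrightarrow> E (u i) (u (Suc i))"
    and far: "real (radius (k + 2)) \<le> cheb (u m) 0"
  shows "c / 96 * cheb (u m) 0 \<le> real m"
proof -
  define r where "r = cheb (u m) 0"
  obtain n where "r < real n" using reals_Archimedean2 by blast
  also have "real n \<le> real (radius n)" using le_radius by simp
  finally have ex: "\<exists>n. r < real (radius n)" by blast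
  define i where "i = (LEAST n. r < real (radius n))"
  have i: "r < real (radius i)" using LeastI_ex[OF ex] unfolding i_def .
  have "k + 2 < i"
  proof (rule ccontr)
    assume "\<not> k + 2 < i"
    then have "real (radius i) \<le> real (radius (k + 2))" using radius_mono[of i "k + 2"] by simp
    then show False using far i unfolding r_def by simp
  qed
  then obtain j where j: "i = j + 3" "k \<le> j"
    using that[of "i - 3"] by linarith
  have low: "real (radius (j + 2)) \<le> r"
    using not_less_Least[of "j + 2" "\<lambda>n. r < real (radius n)"] j unfolding i_def[symmetric] by simp
  show ?thesis
  proof (cases "24 * real (radius (j + 2)) \<le> r")
    case True
    have "c / 4 * r \<le> real m"
      by (rule escape_within_radius[where k = "j + 1" and u = u and E = E])
        (use True i j unblocked u \<open>0 < c\<close> in \<open>auto simp: r_def numeral_3_eq_3\<close>)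
    moreover have "c / 96 * r \<le> c / 4 * r"
      using \<open>0 < c\<close> cheb_nonneg[of "u m" 0] unfolding r_def by (intro mult_right_mono) auto
    ultimately show ?thesis unfolding r_def by simp
  next
    case False
    have "(3::nat) ^ 3 \<le> (j + 2) ^ 3" using j \<open>1 \<le> k\<close> by (intro power_mono) auto
    then have "24 * radius (j + 1) \<le> (j + 2) ^ 3 * radius (j + 1)" by (intro mult_right_mono) auto
    then have "24 * radius (j + 1) \<le> radius (j + 2)" using radius_Suc[of "j + 1"] by simp
    then have gap: "24 * real (radius (j + 1)) \<le> real (radius (j + 2))"
      using of_nat_mono[of "24 * radius (j + 1)" "radius (j + 2)", where 'a = real] by simp
    have "c / 4 * real (radius (j + 2)) \<le> real m"
      by (rule escape_within_radius[where k = j and u = u and E = E, OF \<open>0 < c\<close> _ u gap])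
        (use low j unblocked in \<open>auto simp: r_def\<close>)
    moreover have "c / 96 * r \<le> c / 96 * (24 * real (radius (j + 2)))"
      using False \<open>0 < c\<close> by (intro mult_left_mono) auto
    ultimately show ?thesis unfolding r_def by simp
  qed
qed


section \<open>Almost sure linear growth\<close>

context long_range_percolation
begin

text \<open>
Induction over the scales, simultaneously for all positions. The constant \<open>c\<close> is so small that bad
cubes are impossible at the initial scale, which can be taken as large as the estimates require. In
each step the probability that a scale is blocked is at most the sum of the two budgets, and a bad cube
of the next scale implies that the scale is blocked.
\<close>

lemma prob_blocked_le:
  fixes c C s :: real
  assumes c: "0 < c" "c * 2 * real (radius (k0 + 1)) \<le> 1" and "0 \<le> C"
    and decay: "\<And>k v. k0 \<le> k \<Longrightarrow> real (radius k) < lattice_norm v \<Longrightarrow> p v \<le> C * real (radius k) powr (- s)"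
    and room: "\<And>k. k0 \<le> k \<Longrightarrow> deadline c (k + 2) / deadline c (k + 1) *
        (real (radius (k + 1)) + real (radius k)) + 12 * real (radius (k + 1)) \<le> real (radius (k + 2))"
    and pairs: "\<And>k. k0 \<le> k \<Longrightarrow> real ((2 * (3 * (k + 2) ^ 3) + 1) ^ CARD('d)) ^ 2 * tolerance CARD('d) (k + 1) ^ 2
        \<le> tolerance CARD('d) (k + 2) / 2"
    and long: "\<And>k. k0 \<le> k \<Longrightarrow>
        real ((2 * (radius (k + 1) * (3 * (k + 2) ^ 3)) + 1) ^ CARD('d)) ^ 2 * (C * real (radius k) powr (- s))
        \<le> tolerance CARD('d) (k + 2) / 2"
    and "k0 \<le> k"
  shows "prob {a \<in> space M. blocked (graph a) c k v} \<le> tolerance CARD('d) (k + 2)"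
proof -
  have blocked: "prob {a \<in> space M. blocked (graph a) c k v} \<le> tolerance CARD('d) (k + 2)"
    if "k0 \<le> k"
      and "\<And>z. prob {a \<in> space M. fast_exit (graph a) (radius (k + 1)) (deadline c (k + 1)) z} \<le> tolerance CARD('d) (k + 1)"
    for k v
    unfolding blocked_def
    using prob_obstructed[of "radius k" "C * real (radius k) powr (- s)" "radius (k + 1)" "deadline c (k + 1)"
        "tolerance CARD('d) (k + 1)" "3 * (k + 2) ^ 3" v] decay[OF \<open>k0 \<le> k\<close>] \<open>0 \<le> C\<close> that(2)
      pairs[OF \<open>k0 \<le> k\<close>] long[OF \<open>k0 \<le> k\<close>] by fastforce
  have fast: "prob {a \<in> space M. fast_exit (graph a) (radius (k + 1)) (deadline c (k + 1)) z} \<le> tolerance CARD('d) (k + 1)"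
    if "k0 \<le> k" for k z
    using that
  proof (induction k arbitrary: z rule: dec_induct)
    case base
    have "deadline c (k0 + 1) \<le> 1"
      using deadline_upper[OF c(1), of "k0 + 1"] c(2) by linarith
    then have none: "{a \<in> space M. fast_exit (graph a) (radius (k0 + 1)) (deadline c (k0 + 1)) z} = {}"
      using fast_exit_needs_a_step by blast
    show ?case unfolding none by (simp add: tolerance_def)
  next
    case (step k)
    have "fast_exit (graph a) (radius (k + 2)) (deadline c (k + 2)) z \<Longrightarrow> blocked (graph a) c k z" for a
      unfolding blocked_def
      by (rule fast_exit_imp_obstructed[OF radius_pos radius_mono deadline_pos[OF c(1)] cube_side[symmetric]
            room[OF step.hyps(1)]]) auto
    then have "prob {a \<in> space M. fast_exit (graph a) (radius (k + 2)) (deadline c (k + 2)) z}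
        \<le> prob {a \<in> space M. blocked (graph a) c k z}"
      by (intro finite_measure_mono) (auto simp: blocked_def obstructed_event)
    also have "\<dots> \<le> tolerance CARD('d) (k + 2)"
      by (rule blocked[OF step.hyps(1) step.IH])
    finally show ?case by simp
  qed
  show "prob {a \<in> space M. blocked (graph a) c k v} \<le> tolerance CARD('d) (k + 2)"
    by (rule blocked[OF \<open>k0 \<le> k\<close> fast[OF \<open>k0 \<le> k\<close>]])
qed

lemma summable_tolerance: "0 < d \<Longrightarrow> summable (tolerance d)"
  unfolding tolerance_def
  using inverse_power_summable[of "6 * d + 1", where 'a = real] by (simp add: inverse_eq_divide)

text \<open>
The tolerances are summable, so the Borel-Cantelli lemma applies to the cubes around the origin.
\<close>

lemma AE_eventually_unblocked:
  fixes C s :: real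
  assumes s: "s > 2 * real CARD('d)" and "0 \<le> C"
    and decay: "\<And>v r. r0 \<le> r \<Longrightarrow> 0 < r \<Longrightarrow> r < lattice_norm v \<Longrightarrow> p v \<le> C * r powr (- s)"
  obtains c where "0 < c" "AE a in M. \<forall>\<^sub>F k in sequentially. \<not> blocked (graph a) c k 0"
proof -
  have "\<forall>\<^sub>F k in sequentially. r0 \<le> real k" by real_asymp
  from eventually_conj[OF this eventually_conj[OF eventually_room
        eventually_conj[OF eventually_pair_budget[of "CARD('d)"] eventually_long_budget[OF s \<open>0 \<le> C\<close>]]]]
  obtain k0 where k0: "\<And>k. k0 \<le> k \<Longrightarrow> r0 \<le> real k"
    and room: "\<And>k c. k0 \<le> k \<Longrightarrow> 0 < c \<Longrightarrow> deadline c (k + 2) / deadline c (k + 1) *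
        (real (radius (k + 1)) + real (radius k)) + 12 * real (radius (k + 1)) \<le> real (radius (k + 2))"
    and budget: "\<And>k. k0 \<le> k \<Longrightarrow> real ((2 * (3 * (k + 2) ^ 3) + 1) ^ CARD('d)) ^ 2 * tolerance CARD('d) (k + 1) ^ 2
        \<le> tolerance CARD('d) (k + 2) / 2"
      "\<And>k. k0 \<le> k \<Longrightarrow>
        real ((2 * (radius (k + 1) * (3 * (k + 2) ^ 3)) + 1) ^ CARD('d)) ^ 2 * (C * real (radius k) powr (- s))
        \<le> tolerance CARD('d) (k + 2) / 2"
    unfolding eventually_sequentially by blast
  \<comment> \<open>Makes the deadline at the initial scale at most 1.\<close>
  define c where "c = 1 / (2 * real (radius (k0 + 1)))"
  have c: "0 < c" "c * 2 * real (radius (k0 + 1)) \<le> 1"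
    unfolding c_def using radius_pos[of "k0 + 1"] by auto
  have dec: "p v \<le> C * real (radius k) powr (- s)"
    if "k0 \<le> k" "real (radius k) < lattice_norm v" for k v
    using decay[of "real (radius k)" v] k0[OF that(1)] le_radius[of k] radius_pos[of k] that(2) by simp
  have bnd: "prob {a \<in> space M. blocked (graph a) c k 0} \<le> tolerance CARD('d) (k + 2)" if "k0 \<le> k" for k
    by (rule prob_blocked_le[OF c \<open>0 \<le> C\<close> dec room[OF _ c(1)] budget that])
  have "summable (\<lambda>k. tolerance CARD('d) (k + 2))"
    using summable_tolerance[of "CARD('d)"] by (subst summable_iff_shift) simp
  then have "summable (\<lambda>k. prob {a \<in> space M. blocked (graph a) c k 0})"
    by (rule summable_comparison_test_ev[rotated])
      (use bnd in \<open>auto simp: eventually_sequentially intro!: exI[of _ k0]\<close>)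
  then have "AE a in M. \<forall>\<^sub>F k in sequentially. a \<in> space M - {a \<in> space M. blocked (graph a) c k 0}"
    by (intro borel_cantelli_AE1) (auto simp: blocked_def obstructed_event emeasure_eq_measure)
  then have "AE a in M. \<forall>\<^sub>F k in sequentially. \<not> blocked (graph a) c k 0"
    by eventually_elim (auto elim: eventually_mono)
  then show thesis using that c(1) by blast
qed

end

lemma path_as_sequence:
  assumes "is_path E x vs y"
  obtains u where "u 0 = x" "u (length vs - 1) = y" "\<And>i. i < length vs - 1 \<Longrightarrow> E (u i) (u (Suc i))"
proof
  have vs: "vs \<noteq> []" "hd vs = x" "last vs = y" "successively E vs"
    using assms unfolding is_path_def by auto
  show "vs ! 0 = x" using vs by (simp add: hd_conv_nth)
  show "vs ! (length vs - 1) = y" using vs by (simp add: last_conv_nth)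
  show "E (vs ! i) (vs ! Suc i)" if "i < length vs - 1" for i
    using vs(4) that by (simp add: successively_conv_nth)
qed

lemma graph_dist_lower:
  assumes "\<And>vs. is_path E x vs y \<Longrightarrow> r \<le> real (length vs - 1)"
  shows "ereal r \<le> ereal_of_enat (graph_dist E x y)"
proof -
  have "enat (nat \<lceil>r\<rceil>) \<le> graph_dist E x y"
    unfolding graph_dist_def
  proof (rule INF_greatest)
    fix vs assume "vs \<in> {vs. is_path E x vs y}"
    then have "r \<le> real (length vs - 1)" using assms by blast
    then show "enat (nat \<lceil>r\<rceil>) \<le> enat (length vs - 1)"
      by (simp add: nat_le_iff ceiling_le_iff)
  qed
  then have "ereal_of_enat (enat (nat \<lceil>r\<rceil>)) \<le> ereal_of_enat (graph_dist E x y)"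
    by (simp only: ereal_of_enat_le_iff)
  moreover have "ereal r \<le> ereal_of_enat (enat (nat \<lceil>r\<rceil>))"
    by (simp add: real_nat_ceiling_ge)
  ultimately show ?thesis by (rule order.trans[rotated])
qed

text \<open>
On an outcome with finitely many blocked scales the conclusion is deterministic.
\<close>

lemma graph_dist_linear:
  fixes E :: "int ^ 'd \<Rightarrow> int ^ 'd \<Rightarrow> bool"
  assumes "0 < c" and "\<forall>\<^sub>F k in sequentially. \<not> blocked E c k 0"
  shows "0 < Liminf lattice_at_infinity (\<lambda>x. ereal_of_enat (graph_dist E 0 x) / ereal (lattice_norm x))"
proof -
  obtain k where k: "\<And>j. k \<le> j \<Longrightarrow> \<not> blocked E c j 0"
    using assms(2) unfolding eventually_sequentially by blast
  define k1 where "k1 = Suc k"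
  have k1: "1 \<le> k1" "\<And>j. k1 \<le> j \<Longrightarrow> \<not> blocked E c j 0" unfolding k1_def using k by auto
  define q where "q = sqrt (real CARD('d))"
  have q: "0 < q" unfolding q_def by simp
  define b where "b = c / 96 / q"
  have b: "0 < b" unfolding b_def using q \<open>0 < c\<close> by simp
  have key: "ereal b \<le> ereal_of_enat (graph_dist E 0 x) / ereal (lattice_norm x)"
    if x: "q * real (radius (k1 + 2)) \<le> lattice_norm x" for x
  proof -
    have nrm: "lattice_norm x \<le> q * cheb x 0"
      using lattice_norm_le_cheb[of x 0] unfolding q_def by simp
    have "0 < real (radius (k1 + 2))" using radius_pos[of "k1 + 2"] by simp
    then have pos: "0 < lattice_norm x"
      using x q by (meson less_le_trans mult_pos_pos)
    have far: "real (radius (k1 + 2)) \<le> cheb x 0"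
      using order.trans[OF x nrm] q by simp
    have "ereal (b * lattice_norm x) \<le> ereal_of_enat (graph_dist E 0 x)"
    proof (rule graph_dist_lower)
      fix vs assume "is_path E 0 vs x"
      then obtain u where u: "u 0 = 0" "u (length vs - 1) = x"
          "\<And>i. i < length vs - 1 \<Longrightarrow> E (u i) (u (Suc i))"
        by (rule path_as_sequence) blast
      have "b * lattice_norm x \<le> b * (q * cheb x 0)"
        using nrm b by (intro mult_left_mono) auto
      also have "\<dots> = c / 96 * cheb (u (length vs - 1)) 0"
        unfolding b_def u(2) using q by simp
      also have "\<dots> \<le> real (length vs - 1)"
        by (rule linear_escape[OF \<open>0 < c\<close> k1 u(1,3)]) (use far u in auto)
      finally show "b * lattice_norm x \<le> real (length vs - 1)" .
    qed
    then show ?thesis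
      using pos by (subst ereal_le_divide_pos) (auto simp: mult.commute)
  qed
  have "\<forall>\<^sub>F x in lattice_at_infinity. q * real (radius (k1 + 2)) \<le> lattice_norm (x :: int ^ 'd)"
    unfolding lattice_at_infinity_def by (rule eventually_filtercomapI) (rule eventually_ge_at_top)
  then have "ereal b \<le> Liminf lattice_at_infinity (\<lambda>x. ereal_of_enat (graph_dist E 0 x) / ereal (lattice_norm x))"
    by (intro Liminf_bounded) (rule eventually_mono[OF _ key])
  then show ?thesis using b less_le_trans[of 0 "ereal b"] by simp
qed

lemma decay_from_limit:
  fixes p :: "int ^ 'd \<Rightarrow> real" and s L :: real
  assumes lim: "((\<lambda>k. p k / lattice_norm k powr (- s)) \<longlongrightarrow> L) lattice_at_infinity" and "0 \<le> s" "0 < L"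
  obtains r0 where "\<And>v r. r0 \<le> r \<Longrightarrow> 0 < r \<Longrightarrow> r < lattice_norm v \<Longrightarrow> p v \<le> (L + 1) * r powr (- s)"
proof -
  have "\<forall>\<^sub>F k in lattice_at_infinity. p k / lattice_norm k powr (- s) < L + 1"
    by (rule order_tendstoD[OF lim]) simp
  then obtain r0 where r0: "\<And>v. r0 \<le> lattice_norm v \<Longrightarrow> p v / lattice_norm v powr (- s) < L + 1"
    unfolding lattice_at_infinity_def eventually_filtercomap eventually_at_top_linorder by blast
  have "p v \<le> (L + 1) * r powr (- s)" if "r0 \<le> r" "0 < r" "r < lattice_norm v" for v r
  proof -
    have "p v \<le> (L + 1) * lattice_norm v powr (- s)"
      using r0[of v] that by (simp add: divide_less_eq less_imp_le)
    also have "\<dots> \<le> (L + 1) * r powr (- s)"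
      using that assms by (intro mult_left_mono powr_mono2') auto
    finally show ?thesis .
  qed
  then show thesis using that by blast
qed

theorem theorem1:
  fixes M :: "'a measure"
    and p :: "int ^ 'd \<Rightarrow> real"
    and \<omega> :: "(int ^ 'd) uprod \<Rightarrow> 'a \<Rightarrow> bool"
    and s L :: real
  assumes "s > 2 * real CARD('d)"
    and "\<And>k. 0 \<le> p k \<and> p k \<le> 1"
    and "\<And>k. p k = p (- k)"
    and "((\<lambda>k. p k / lattice_norm k powr (- s)) \<longlongrightarrow> L) lattice_at_infinity"
    and "0 < L"
    and "long_range_percolation M p \<omega>"
  shows "AE a in M. 0 < Liminf lattice_at_infinity
           (\<lambda>x. ereal_of_enat (chemical_dist \<omega> a 0 x) / ereal (lattice_norm x))"
proof -
  interpret long_range_percolation M p \<omega> by fact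
  have "0 \<le> s"
    using assms(1) by (rule order.trans[rotated, OF less_imp_le]) simp
  obtain r0 where decay: "\<And>v r. r0 \<le> r \<Longrightarrow> 0 < r \<Longrightarrow> r < lattice_norm v \<Longrightarrow> p v \<le> (L + 1) * r powr (- s)"
    using decay_from_limit[OF assms(4) \<open>0 \<le> s\<close> assms(5)] by blast
  have "0 \<le> L + 1" using assms(5) by simp
  obtain c where "0 < c" and AE: "AE a in M. \<forall>\<^sub>F k in sequentially. \<not> blocked (graph a) c k 0"
    using AE_eventually_unblocked[OF assms(1) \<open>0 \<le> L + 1\<close> decay] by blast
  from AE show ?thesis
    unfolding chemical_dist_def by eventually_elim (rule graph_dist_linear[OF \<open>0 < c\<close>])
qed

end
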